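(* Let $g,b,z_d\in\mathbb{R}$ and $M_2>0$. Let $u_{q_{op}}$ be the solution of $(S)$ for $q=q_{op}$, the minimizer of $J_2$ over $\mathbb{R}$, and for $h=x_0/n$ let $u^h_{q^h_{op}}$ be the discrete solution for $q=q^h_{op}$, the minimizer of $J_2^h$ over $\mathbb{R}$. Then there are constants $C_{10},C_{11}$ not depending on $h$ such that, as $h\to0$ ($h=x_0/n$, $n\to\infty$), $$\text{(a)}\quad\|u^h_{q^h_{op}}-u_{q_{op}}\|_H=C_{10}h+o(h),\qquad\text{(b)}\quad\left\|\frac{\partial u^h_{q^h_{op}}}{\partial x}-\frac{\partial u_{q_{op}}}{\partial x}\right\|_H=C_{11}h+o(h).$$
   Context: Fix $x_0,y_0>0$, $\Omega=(0,x_0)\times(0,y_0)$, $\Gamma_2=\{x_0\}\times(0,y_0]$, $H=L^2(\Omega)$, $Q=L^2(\Gamma_2)$ with their standard norms. For constants $g,q,b\in\mathbb{R}$, system $(S)$: $-\Delta u=g$ in $\Omega$, $u=b$ on $\{0\}\times(0,y_0]$, $-\partial u/\partial n=q$ on $\Gamma_2$, $-\partial u/\partial n=0$ on $[0,x_0]\times\{0,y_0\}$, has solution $u_q(x,y)=-\tfrac12gx^2+(gx_0-q)x+b$. For an integer $n\ge1$, $h=x_0/n$, $x_i=(i-1)h$, its discrete (finite-difference, piecewise linear) approximation is $u^h_q(x,y)=(gx_0-q-hgi)x+h^2g\tfrac{i(i-1)}2+b$ for $x\in[x_i,x_{i+1}]$, $y\in[0,y_0]$, $i=1,\dots,n$ (its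 $x$-derivative is piecewise constant, defined a.e.). For fixed $g,b,z_d\in\mathbb{R}$ and $M_2>0$ the cost functions on $\mathbb{R}$ are $J_2(q)=\tfrac12\|u_q-z_d\|_H^2+\tfrac{M_2}2\|q\|_Q^2$ and $J^h_2(q)=\tfrac12\|u^h_q-z_d\|_H^2+\tfrac{M_2}2\|q\|_Q^2$, where $\|q\|_Q^2=y_0q^2$ for constant $q$. With $B_1=\left(\frac13+\frac{M_2}{x_0^3}\right)^{-1}$, the minimizers are $q_{op}=\frac{B_1}{2x_0}\left(\frac5{12}gx_0^2+(b-z_d)\right)$ and $q^h_{op}=q_{op}-B_1\frac{gh}6-B_1\frac{gh^2}{24x_0}$. *)

theory Defs
  imports "HOL-Analysis.Analysis" "HOL-Library.Landau_Symbols"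
begin

definition Omega :: "real \<Rightarrow> real \<Rightarrow> (real \<times> real) set" where
  "Omega x0 y0 = {0<..<x0} \<times> {0<..<y0}"

(* Meaningful for square-integrable f only: the integral is 0 by convention
   otherwise. *)
definition H_norm :: "real \<Rightarrow> real \<Rightarrow> (real \<times> real \<Rightarrow> real) \<Rightarrow> real" where
  "H_norm x0 y0 f = sqrt (LINT p:Omega x0 y0|lborel. (f p)\<^sup>2)"

(* The boundary piece {x0} x (0, y0] is parametrised by arc length y. *)
definition Q_norm :: "real \<Rightarrow> real \<Rightarrow> (real \<times> real \<Rightarrow> real) \<Rightarrow> real" where
  "Q_norm x0 y0 f = sqrt (LINT y:{0<..y0}|lborel. (f (x0, y))\<^sup>2)"

(* Only an almost-everywhere notion for piecewise affine f: at kinks deriv has an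
   unspecified value, which does not affect H_norm. *)
definition partial_x :: "(real \<times> real \<Rightarrow> real) \<Rightarrow> real \<times> real \<Rightarrow> real" where
  "partial_x f = (\<lambda>(x, y). deriv (\<lambda>t. f (t, y)) x)"

(* One-sided derivative at a boundary point p in the direction of the outward
   normal \<nu>; p is approached from inside the domain (t < 0), so values of f
   outside the closed domain play no role. *)
definition has_normal_derivative ::
    "(real \<times> real \<Rightarrow> real) \<Rightarrow> real \<Rightarrow> real \<times> real \<Rightarrow> real \<times> real \<Rightarrow> bool" where
  "has_normal_derivative f D p \<nu> \<longleftrightarrow>
     ((\<lambda>t. f (p + t *\<^sub>R \<nu>)) has_real_derivative D) (at_left 0)"

(* Existence of the pure second partial derivatives in the open rectangle,
   together with the equation -(u_xx + u_yy) = g. *)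
definition solves_poisson ::
    "real \<Rightarrow> real \<Rightarrow> real \<Rightarrow> (real \<times> real \<Rightarrow> real) \<Rightarrow> bool" where
  "solves_poisson x0 y0 g u \<longleftrightarrow>
     (\<exists>ux uy uxx uyy. \<forall>x y. (x, y) \<in> Omega x0 y0 \<longrightarrow>
        ((\<lambda>t. u (t, y)) has_real_derivative ux (x, y)) (at x) \<and>
        ((\<lambda>t. ux (t, y)) has_real_derivative uxx (x, y)) (at x) \<and>
        ((\<lambda>s. u (x, s)) has_real_derivative uy (x, y)) (at y) \<and>
        ((\<lambda>s. uy (x, s)) has_real_derivative uyy (x, y)) (at y) \<and>
        - (uxx (x, y) + uyy (x, y)) = g)"

(* u is a classical solution, continuous up to the boundary, of system (S).
   At the corners on the horizontal sides the normal is that of the side. *)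
definition solves_S ::
    "real \<Rightarrow> real \<Rightarrow> real \<Rightarrow> real \<Rightarrow> real \<Rightarrow> (real \<times> real \<Rightarrow> real) \<Rightarrow> bool" where
  "solves_S x0 y0 g q b u \<longleftrightarrow>
     continuous_on ({0..x0} \<times> {0..y0}) u \<and>
     solves_poisson x0 y0 g u \<and>
     (\<forall>y\<in>{0<..y0}. u (0, y) = b) \<and>
     (\<forall>y\<in>{0<..y0}. has_normal_derivative u (- q) (x0, y) (1, 0)) \<and>
     (\<forall>x\<in>{0..x0}. has_normal_derivative u 0 (x, 0) (0, -1)) \<and>
     (\<forall>x\<in>{0..x0}. has_normal_derivative u 0 (x, y0) (0, 1))"

lemma solves_S_explicit:
  "solves_S x0 y0 g q b (\<lambda>(x, y). - (1/2) * g * x\<^sup>2 + (g * x0 - q) * x + b)"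
proof -
  have "solves_poisson x0 y0 g (\<lambda>(x, y). - (1/2) * g * x\<^sup>2 + (g * x0 - q) * x + b)"
    unfolding solves_poisson_def
    by (rule exI[of _ "\<lambda>(x, y). - g * x + (g * x0 - q)"], rule exI[of _ "\<lambda>_. 0"],
        rule exI[of _ "\<lambda>_. - g"], rule exI[of _ "\<lambda>_. 0"])
       (auto intro!: derivative_eq_intros)
  moreover have "continuous_on ({0..x0} \<times> {0..y0})
      (\<lambda>(x, y::real). - (1/2) * g * x\<^sup>2 + (g * x0 - q) * x + b)"
    by (auto simp: case_prod_unfold intro!: continuous_intros)
  ultimately show ?thesis
    unfolding solves_S_def has_normal_derivative_def
    by (auto intro!: derivative_eq_intros)
qed

(* On the cell [(i-1)h, ih] the index is i = ceiling (x/h); at the nodes the two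
   adjacent formulas agree, see discrete_sol_cell. *)
definition discrete_sol ::
    "real \<Rightarrow> nat \<Rightarrow> real \<Rightarrow> real \<Rightarrow> real \<Rightarrow> real \<times> real \<Rightarrow> real" where
  "discrete_sol x0 n g q b = (\<lambda>(x, y).
     let h = x0 / real n; i = real_of_int \<lceil>x / h\<rceil>
     in (g * x0 - q - h * g * i) * x + h\<^sup>2 * g * (i * (i - 1) / 2) + b)"

lemma discrete_sol_cell:
  fixes x0 :: real and n i :: nat
  defines "h \<equiv> x0 / real n"
  assumes "x0 > 0" "1 \<le> i" "i \<le> n" "x \<in> {(real i - 1) * h..real i * h}"
  shows "discrete_sol x0 n g q b (x, y) =
    (g * x0 - q - h * g * real i) * x + h\<^sup>2 * g * (real i * (real i - 1) / 2) + b"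
proof -
  have h: "h > 0" using assms by (simp add: h_def)
  show ?thesis
  proof (cases "x = (real i - 1) * h")
    case True
    have "x / h = of_int (int i - 1)" using True h by simp
    then have "real_of_int \<lceil>x / h\<rceil> = real i - 1"
      by (metis ceiling_of_int of_int_1 of_int_diff of_int_of_nat_eq)
    then show ?thesis
      using True by (simp add: discrete_sol_def Let_def flip: h_def)
        (simp add: field_simps power2_eq_square)
  next
    case False
    then have "real i - 1 < x / h" "x / h \<le> real i"
      using assms h by (auto simp: field_simps)
    then have "\<lceil>x / h\<rceil> = int i" by (simp add: ceiling_eq_iff)
    then show ?thesis by (simp add: discrete_sol_def Let_def flip: h_def)
  qed
qed

(* The cost q |-> 1/2 |u_q - z_d|_H^2 + M2/2 |q|_Q^2 of a family of states u_q,
   with the control restricted to constants q. *)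
definition cost ::
    "real \<Rightarrow> real \<Rightarrow> real \<Rightarrow> real \<Rightarrow> (real \<Rightarrow> real \<times> real \<Rightarrow> real) \<Rightarrow> real \<Rightarrow> real" where
  "cost x0 y0 M2 zd u q =
     1/2 * (H_norm x0 y0 (\<lambda>p. u q p - zd))\<^sup>2 + M2/2 * (Q_norm x0 y0 (\<lambda>_. q))\<^sup>2"

end

theory Submission imports Defs begin

text \<open>The system has one classical solution only, the quadratic polynomial in \<open>x\<close> of
  \<open>solves_S_explicit\<close>: the difference of two solutions is harmonic with zero data, and a maximum
  principle with a barrier (\<open>maximum_principle_mixed\<close>) shows that it vanishes. So all functions
  involved depend on \<open>x\<close> only, and the norms reduce to integrals over \<open>(0, x0)\<close>.

  For a control \<open>q\<close> the exact state is \<open>U x - q * x\<close>. With \<open>r\<close> the distance from \<open>x\<close> to the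
  right end of its cell, the discrete state is
  \<open>U x - g / 2 * (h * x + r * (h - r)) - q * x\<close> (\<open>discrete_sol_defect\<close>), and \<open>0 \<le> r < h\<close>.
  Hence the error for fixed \<open>q\<close>, divided by \<open>h\<close>, converges uniformly to \<open>- g * x / 2\<close>.

  The costs are quadratic in \<open>q\<close> with the same leading coefficient, and the minimizers solve
  \<open>(x0 ^ 3 / 3 + M2) * q = \<integral> (k x - zd) * x dx\<close>, where \<open>k\<close> is the state for the control \<open>0\<close>
  (\<open>optimal_control_equation\<close>). Subtracting the two equations, the control error divided by \<open>h\<close>
  has a limit \<open>c\<close>. Dominated convergence then gives (a), with \<open>C10\<close> the norm of
  \<open>g * x / 2 + c * x\<close>.

  The error of the derivatives is \<open>- (g * r + \<delta>)\<close> up to the nodes, where \<open>\<delta>\<close> is the control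
  error. Summing the integral of its square over the cells (\<open>has_integral_cell_gap_square\<close>) gives
  exactly \<open>x0 * (g\<^sup>2 * h\<^sup>2 / 3 + g * \<delta> * h + \<delta>\<^sup>2)\<close>, which proves (b).\<close>

section \<open>Uniqueness of classical solutions\<close>

text \<open>The second derivative test under the weak regularity of a classical solution: the second
  derivative exists at the maximum, but it need not be continuous. If it were positive, the first
  derivative, which vanishes at the maximum, would be positive just to the right of it.\<close>

lemma second_derivative_nonpos_at_max:
  fixes f f' :: "real \<Rightarrow> real"
  assumes x: "x \<in> {a<..<b}"
    and f: "\<And>t. t \<in> {a<..<b} \<Longrightarrow> (f has_real_derivative f' t) (at t)"
    and f': "(f' has_real_derivative c) (at x)"
    and max: "\<And>t. t \<in> {a<..<b} \<Longrightarrow> f t \<le> f x"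
  shows "c \<le> 0"
proof (rule ccontr)
  assume "\<not> c \<le> 0"
  then have "c > 0" by simp
  define e where "e = min (x - a) (b - x)"
  have e: "e > 0" "\<And>t. \<bar>x - t\<bar> < e \<Longrightarrow> t \<in> {a<..<b}"
    using x by (auto simp: e_def)
  have "f' x = 0"
    using DERIV_local_max[OF f[OF x] e(1)] max e(2) by blast
  obtain d where d: "d > 0" "\<And>k. 0 < k \<Longrightarrow> k < d \<Longrightarrow> f' x < f' (x + k)"
    using DERIV_pos_inc_right[OF f' \<open>c > 0\<close>] by blast
  define y where "y = x + min d e / 2"
  have y: "x < y" "y < x + d" "y < x + e" using d(1) e(1) by (auto simp: y_def min_def field_simps)
  have "f x < f y"
  proof (rule DERIV_pos_imp_increasing_open[OF y(1)])
    fix t assume t: "x < t" "t < y"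
    then have "f' t > 0" using d(2)[of "t - x"] y \<open>f' x = 0\<close> by simp
    moreover have "t \<in> {a<..<b}" using t y e(2) by simp
    ultimately show "\<exists>l. (f has_real_derivative l) (at t) \<and> l > 0" using f by blast
  next
    have "t \<in> {a<..<b}" if "t \<in> {x..y}" for t using that y by (intro e(2)) auto
    then show "continuous_on {x..y} f"
      by (intro continuous_at_imp_continuous_on ballI DERIV_isCont[OF f])
  qed
  moreover have "f y \<le> f x" using max e(2) y by simp
  ultimately show False by simp
qed

text \<open>Moving inwards from a boundary maximum means \<open>t < 0\<close>, where both the increment of \<open>v\<close> and \<open>t\<close>
  are nonpositive.\<close>

lemma normal_derivative_nonneg_at_max:
  assumes D: "has_normal_derivative v D p \<nu>"
    and max: "\<forall>\<^sub>F t in at_left 0. v (p + t *\<^sub>R \<nu>) \<le> v p"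
  shows "D \<ge> 0"
proof (rule tendsto_lowerbound)
  show "((\<lambda>t. (v (p + t *\<^sub>R \<nu>) - v p) / t) \<longlongrightarrow> D) (at_left 0)"
    using D by (simp add: has_normal_derivative_def has_field_derivative_iff)
  have "\<forall>\<^sub>F t::real in at_left 0. t < 0" by (simp add: eventually_at_filter)
  with max show "\<forall>\<^sub>F t in at_left 0. (v (p + t *\<^sub>R \<nu>) - v p) / t \<ge> 0"
    by eventually_elim (simp add: zero_le_divide_iff)
qed simp

lemma has_normal_derivative_add:
  assumes "has_normal_derivative v D p \<nu>" "has_normal_derivative w E p \<nu>"
  shows "has_normal_derivative (\<lambda>p. v p + w p) (D + E) p \<nu>"
  using assms unfolding has_normal_derivative_def by (rule DERIV_add)

lemma solves_S_diff:
  assumes "solves_S x0 y0 g q b u" "solves_S x0 y0 g' q' b' u'"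
  shows "solves_S x0 y0 (g - g') (q - q') (b - b') (\<lambda>p. u p - u' p)"
proof -
  obtain ux uy uxx uyy where u: "\<And>x y. (x, y) \<in> Omega x0 y0 \<Longrightarrow>
        ((\<lambda>t. u (t, y)) has_real_derivative ux (x, y)) (at x) \<and>
        ((\<lambda>t. ux (t, y)) has_real_derivative uxx (x, y)) (at x) \<and>
        ((\<lambda>s. u (x, s)) has_real_derivative uy (x, y)) (at y) \<and>
        ((\<lambda>s. uy (x, s)) has_real_derivative uyy (x, y)) (at y) \<and>
        - (uxx (x, y) + uyy (x, y)) = g"
    using assms(1) unfolding solves_S_def solves_poisson_def by blast
  obtain vx vy vxx vyy where v: "\<And>x y. (x, y) \<in> Omega x0 y0 \<Longrightarrow>
        ((\<lambda>t. u' (t, y)) has_real_derivative vx (x, y)) (at x) \<and>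
        ((\<lambda>t. vx (t, y)) has_real_derivative vxx (x, y)) (at x) \<and>
        ((\<lambda>s. u' (x, s)) has_real_derivative vy (x, y)) (at y) \<and>
        ((\<lambda>s. vy (x, s)) has_real_derivative vyy (x, y)) (at y) \<and>
        - (vxx (x, y) + vyy (x, y)) = g'"
    using assms(2) unfolding solves_S_def solves_poisson_def by blast
  have "solves_poisson x0 y0 (g - g') (\<lambda>p. u p - u' p)"
    unfolding solves_poisson_def
  proof (rule exI[of _ "\<lambda>p. ux p - vx p"], rule exI[of _ "\<lambda>p. uy p - vy p"],
      rule exI[of _ "\<lambda>p. uxx p - vxx p"], rule exI[of _ "\<lambda>p. uyy p - vyy p"],
      intro allI impI, goal_cases)
    case (1 x y)
    show ?case using u[OF 1] v[OF 1] by (auto intro!: DERIV_diff)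
  qed
  moreover have "has_normal_derivative (\<lambda>p. u p - u' p) (D - E) p \<nu>"
    if "has_normal_derivative u D p \<nu>" "has_normal_derivative u' E p \<nu>" for D E p \<nu>
    using that unfolding has_normal_derivative_def by (rule DERIV_diff)
  note this[where D = "- q" and E = "- q'"] this[where D = 0 and E = 0]
  ultimately show ?thesis
    using assms unfolding solves_S_def by (auto intro!: continuous_intros)
qed

text \<open>A harmonic \<open>w\<close> may have interior maxima, and a zero normal derivative does not exclude boundary
  maxima, so \<open>w\<close> is perturbed by a small multiple of a barrier \<open>\<phi>\<close> which makes both signs strict:
  \<open>\<phi>\<close> has Laplacian \<open>4 - 2 > 0\<close>, and its outward normal derivatives are \<open>- 4\<close> on the side \<open>x = x0\<close>
  and \<open>- y0\<close> on the horizontal sides. The perturbed function can then attain its maximum on the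
  Dirichlet side only, where \<open>w = 0\<close>.\<close>

lemma maximum_principle_mixed:
  assumes x0: "x0 > 0" and y0: "y0 > 0"
    and w: "solves_S x0 y0 0 0 0 w"
    and p: "p \<in> {0..x0} \<times> {0..y0}"
  shows "w p \<le> 0"
proof (rule field_le_epsilon)
  define \<phi> :: "real \<times> real \<Rightarrow> real"
    where "\<phi> = (\<lambda>(x, y). 2 * (x0 + 1 - x)\<^sup>2 - (y - y0 / 2)\<^sup>2)"
  \<comment> \<open>an upper bound for the oscillation of \<open>\<phi>\<close> on the closed rectangle\<close>
  define K where "K = 2 * (x0 + 1)\<^sup>2 + (y0 / 2)\<^sup>2"
  have K: "K > 0" using x0 y0 by (simp add: K_def add_pos_nonneg)
  fix \<epsilon> :: real assume "\<epsilon> > 0"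
  define e where "e = \<epsilon> / K"
  have e: "e > 0" using \<open>\<epsilon> > 0\<close> K by (simp add: e_def)
  define v where "v = (\<lambda>p. w p + e * \<phi> p)"
  let ?R = "{0..x0} \<times> {0..y0}"
  have "continuous_on ?R v"
    using w unfolding v_def \<phi>_def solves_S_def
    by (auto simp: case_prod_unfold intro!: continuous_intros)
  moreover have "compact ?R" by (intro compact_Times compact_Icc)
  ultimately obtain p0 where p0: "p0 \<in> ?R" and max: "\<And>p. p \<in> ?R \<Longrightarrow> v p \<le> v p0"
    using continuous_attains_sup[of ?R v] p by blast
  obtain a c where ac: "p0 = (a, c)" "0 \<le> a" "a \<le> x0" "0 \<le> c" "c \<le> y0"
    using p0 by (cases p0) auto
  have ev: "\<forall>\<^sub>F t in at_left 0. - d < t \<and> t < (0::real)" if "d > 0" for d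
    using eventually_at_left_real[of "- d" 0] that by simp
  \<comment> \<open>At a maximum on a Neumann side the outward derivative would be nonnegative, but there it is
    that of \<open>e * \<phi>\<close>, which is negative. The horizontal sides come first, since they contain all
    four corners; the Dirichlet and the flux condition are then needed for \<open>0 < c < y0\<close> only.\<close>
  have "c \<noteq> 0"
  proof
    assume "c = 0"
    have "has_normal_derivative v (0 + e * (- y0)) p0 (0, - 1)"
      unfolding v_def
    proof (rule has_normal_derivative_add)
      show "has_normal_derivative w 0 p0 (0, - 1)"
        using w ac \<open>c = 0\<close> unfolding solves_S_def by auto
      show "has_normal_derivative (\<lambda>p. e * \<phi> p) (e * (- y0)) p0 (0, - 1)"
        unfolding has_normal_derivative_def ac \<open>c = 0\<close> \<phi>_def
        by (auto intro!: derivative_eq_intros)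
    qed
    moreover have "\<forall>\<^sub>F t in at_left 0. v (p0 + t *\<^sub>R (0, - 1)) \<le> v p0"
      using ev[OF y0] by eventually_elim (use ac \<open>c = 0\<close> in \<open>intro max, auto\<close>)
    ultimately have "0 + e * (- y0) \<ge> 0" by (rule normal_derivative_nonneg_at_max)
    with e y0 mult_pos_pos[OF e y0] show False by simp
  qed
  moreover have "c \<noteq> y0"
  proof
    assume "c = y0"
    have "has_normal_derivative v (0 + e * (- y0)) p0 (0, 1)"
      unfolding v_def
    proof (rule has_normal_derivative_add)
      show "has_normal_derivative w 0 p0 (0, 1)"
        using w ac \<open>c = y0\<close> unfolding solves_S_def by auto
      show "has_normal_derivative (\<lambda>p. e * \<phi> p) (e * (- y0)) p0 (0, 1)"
        unfolding has_normal_derivative_def ac \<open>c = y0\<close> \<phi>_def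
        by (auto intro!: derivative_eq_intros)
    qed
    moreover have "\<forall>\<^sub>F t in at_left 0. v (p0 + t *\<^sub>R (0, 1)) \<le> v p0"
      using ev[OF y0] by eventually_elim (use ac \<open>c = y0\<close> in \<open>intro max, auto\<close>)
    ultimately have "0 + e * (- y0) \<ge> 0" by (rule normal_derivative_nonneg_at_max)
    with e y0 mult_pos_pos[OF e y0] show False by simp
  qed
  ultimately have c: "0 < c" "c < y0" using ac by auto
  have "a \<noteq> x0"
  proof
    assume "a = x0"
    have "has_normal_derivative v (0 + e * (- 4)) p0 (1, 0)"
      unfolding v_def
    proof (rule has_normal_derivative_add)
      show "has_normal_derivative w 0 p0 (1, 0)"
        using w ac c \<open>a = x0\<close> unfolding solves_S_def by auto
      show "has_normal_derivative (\<lambda>p. e * \<phi> p) (e * (- 4)) p0 (1, 0)"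
        unfolding has_normal_derivative_def ac \<open>a = x0\<close> \<phi>_def
        by (auto intro!: derivative_eq_intros)
    qed
    moreover have "\<forall>\<^sub>F t in at_left 0. v (p0 + t *\<^sub>R (1, 0)) \<le> v p0"
      using ev[OF x0] by eventually_elim (use ac \<open>a = x0\<close> in \<open>intro max, auto\<close>)
    ultimately have "0 + e * (- 4) \<ge> 0" by (rule normal_derivative_nonneg_at_max)
    with e show False by simp
  qed
  have "a = 0"
  proof (rule ccontr)
    assume "a \<noteq> 0"
    with ac \<open>a \<noteq> x0\<close> have a: "0 < a" "a < x0" by auto
    obtain wx wy wxx wyy where d: "\<And>x y. (x, y) \<in> Omega x0 y0 \<Longrightarrow>
        ((\<lambda>t. w (t, y)) has_real_derivative wx (x, y)) (at x) \<and>
        ((\<lambda>t. wx (t, y)) has_real_derivative wxx (x, y)) (at x) \<and>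
        ((\<lambda>s. w (x, s)) has_real_derivative wy (x, y)) (at y) \<and>
        ((\<lambda>s. wy (x, s)) has_real_derivative wyy (x, y)) (at y) \<and>
        - (wxx (x, y) + wyy (x, y)) = 0"
      using w unfolding solves_S_def solves_poisson_def by blast
    have "wxx (a, c) + e * 4 \<le> 0"
    proof (rule second_derivative_nonpos_at_max)
      show "a \<in> {0<..<x0}" using a by simp
      show "((\<lambda>x. v (x, c)) has_real_derivative wx (t, c) + e * (4 * (t - x0 - 1))) (at t)"
        if "t \<in> {0<..<x0}" for t
        unfolding v_def \<phi>_def using that c d[of t c]
        by (auto simp: Omega_def intro!: derivative_eq_intros)
      show "((\<lambda>t. wx (t, c) + e * (4 * (t - x0 - 1))) has_real_derivative
               wxx (a, c) + e * 4) (at a)"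
        using a c d[of a c] by (auto simp: Omega_def intro!: derivative_eq_intros)
      show "v (t, c) \<le> v (a, c)" if "t \<in> {0<..<x0}" for t
        using max[of "(t, c)"] that c ac by simp
    qed
    moreover have "wyy (a, c) + e * (- 2) \<le> 0"
    proof (rule second_derivative_nonpos_at_max)
      show "c \<in> {0<..<y0}" using c by simp
      show "((\<lambda>y. v (a, y)) has_real_derivative wy (a, t) + e * (- 2 * (t - y0 / 2))) (at t)"
        if "t \<in> {0<..<y0}" for t
        unfolding v_def \<phi>_def using that a d[of a t]
        by (auto simp: Omega_def intro!: derivative_eq_intros)
      show "((\<lambda>t. wy (a, t) + e * (- 2 * (t - y0 / 2))) has_real_derivative
               wyy (a, c) + e * (- 2)) (at c)"
        using a c d[of a c] by (auto simp: Omega_def intro!: derivative_eq_intros)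
      show "v (a, t) \<le> v (a, c)" if "t \<in> {0<..<y0}" for t
        using max[of "(a, t)"] that a ac by simp
    qed
    moreover have "wxx (a, c) + wyy (a, c) = 0"
      using d[of a c] a c by (simp add: Omega_def)
    ultimately show False using e by simp
  qed
  have "w p0 = 0" using w ac c \<open>a = 0\<close> unfolding solves_S_def by simp
  then have "v p0 \<le> e * (2 * (x0 + 1)\<^sup>2)"
    using e unfolding v_def \<phi>_def ac \<open>a = 0\<close> by simp
  moreover have "\<phi> p \<ge> - (y0 / 2)\<^sup>2"
  proof -
    have "\<bar>snd p - y0 / 2\<bar> \<le> \<bar>y0 / 2\<bar>" using p by (cases p) (auto simp: abs_if)
    then have "(snd p - y0 / 2)\<^sup>2 \<le> (y0 / 2)\<^sup>2" using abs_le_square_iff by blast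
    moreover have "2 * (x0 + 1 - fst p)\<^sup>2 \<ge> 0" by simp
    ultimately have "- (y0 / 2)\<^sup>2 \<le> 2 * (x0 + 1 - fst p)\<^sup>2 - (snd p - y0 / 2)\<^sup>2" by linarith
    then show ?thesis by (simp add: \<phi>_def case_prod_unfold)
  qed
  then have "e * \<phi> p \<ge> e * (- (y0 / 2)\<^sup>2)" using e by (intro mult_left_mono) auto
  ultimately have "w p \<le> e * K"
    using max[OF p] by (simp add: v_def K_def algebra_simps)
  then show "w p \<le> 0 + \<epsilon>" using K by (simp add: e_def)
qed

lemma solves_S_unique:
  assumes "x0 > 0" "y0 > 0" "solves_S x0 y0 g q b u" "solves_S x0 y0 g q b v"
    and "p \<in> {0..x0} \<times> {0..y0}"
  shows "u p = v p"
proof (rule antisym)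
  show "u p \<le> v p"
    using maximum_principle_mixed[OF assms(1,2) _ assms(5), of "\<lambda>p. u p - v p"]
      solves_S_diff[OF assms(3,4)] by simp
  show "v p \<le> u p"
    using maximum_principle_mixed[OF assms(1,2) _ assms(5), of "\<lambda>p. v p - u p"]
      solves_S_diff[OF assms(4,3)] by simp
qed

text \<open>By uniqueness, any classical solution is the explicit quadratic polynomial, written here
  with the control split off.\<close>

lemma solves_S_eq:
  assumes "x0 > 0" "y0 > 0" "solves_S x0 y0 g q b u" "(x, y) \<in> Omega x0 y0"
  shows "u (x, y) = (- (1/2) * g * x\<^sup>2 + g * x0 * x + b) - q * x"
  using solves_S_unique[OF assms(1-3) solves_S_explicit, of "(x, y)"] assms(4)
  by (simp add: Omega_def algebra_simps)

lemma partial_x_solves_S: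
  assumes "x0 > 0" "y0 > 0" "solves_S x0 y0 g q b u" and p: "(x, y) \<in> Omega x0 y0"
  shows "partial_x u (x, y) = - g * x + (g * x0 - q)"
proof -
  have "((\<lambda>t. u (t, y)) has_real_derivative - g * x + (g * x0 - q)) (at x)"
  proof (rule has_field_derivative_transform_within_open[of _ _ _ "{0<..<x0}"])
    show "((\<lambda>t. (- (1/2) * g * t\<^sup>2 + g * x0 * t + b) - q * t) has_real_derivative
        - g * x + (g * x0 - q)) (at x)"
      by (auto intro!: derivative_eq_intros)
    show "(- (1/2) * g * t\<^sup>2 + g * x0 * t + b) - q * t = u (t, y)" if "t \<in> {0<..<x0}" for t
      using solves_S_eq[OF assms(1-3), of t y] p that by (simp add: Omega_def)
  qed (use p in \<open>auto simp: Omega_def\<close>)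
  then show ?thesis by (simp add: partial_x_def DERIV_imp_deriv)
qed

section \<open>Integrals over the interval and the optimal control\<close>

lemma set_integrable_Ioo_bounded:
  fixes f :: "real \<Rightarrow> real"
  assumes [measurable]: "f \<in> borel_measurable borel"
    and bound: "\<And>x. x \<in> {a<..<b} \<Longrightarrow> \<bar>f x\<bar> \<le> C"
  shows "set_integrable lborel {a<..<b} f"
  unfolding set_integrable_def
proof (rule integrableI_bounded_set_indicator[where B = C])
  show "emeasure lborel {a<..<b} < \<infinity>"
    by (intro emeasure_bounded_finite bounded_box[of a b, unfolded box_real])
  show "AE x in lborel. x \<in> {a<..<b} \<longrightarrow> norm (f x) \<le> C" using bound by auto
qed auto

lemma set_integral_Ioo_eq_has_integral:
  fixes f :: "real \<Rightarrow> real"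
  assumes "f \<in> borel_measurable borel" "\<And>x. x \<in> {a<..<b} \<Longrightarrow> \<bar>f x\<bar> \<le> C"
    and "(f has_integral I) {a..b}"
  shows "(LINT x:{a<..<b}|lborel. f x) = I"
proof -
  have "(f has_integral I) {a<..<b}" using assms(3) has_integral_Icc_iff_Ioo by blast
  then show ?thesis
    using set_borel_integral_eq_integral(2)[OF set_integrable_Ioo_bounded[OF assms(1,2)]]
    by (simp add: integral_unique)
qed

lemma set_integral_Ioo_dominated_convergence:
  fixes s :: "nat \<Rightarrow> real \<Rightarrow> real"
  assumes [measurable]: "\<And>n. s n \<in> borel_measurable borel" "f \<in> borel_measurable borel"
    and bound: "\<And>n x. x \<in> {a<..<b} \<Longrightarrow> \<bar>s n x\<bar> \<le> C"
    and lim: "\<And>x. x \<in> {a<..<b} \<Longrightarrow> (\<lambda>n. s n x) \<longlonglongrightarrow> f x"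
  shows "(\<lambda>n. LINT x:{a<..<b}|lborel. s n x) \<longlonglongrightarrow> (LINT x:{a<..<b}|lborel. f x)"
  unfolding set_lebesgue_integral_def
proof (rule integral_dominated_convergence[where w = "\<lambda>x. indicator {a<..<b} x *\<^sub>R C"])
  show "integrable lborel (\<lambda>x. indicator {a<..<b} x *\<^sub>R C)"
    using set_integrable_Ioo_bounded[of "\<lambda>_. C" a b "\<bar>C\<bar>"] by (simp add: set_integrable_def)
  show "AE x in lborel. (\<lambda>n. indicator {a<..<b} x *\<^sub>R s n x) \<longlonglongrightarrow> indicator {a<..<b} x *\<^sub>R f x"
    using lim by (auto simp: indicator_def)
  show "AE x in lborel. norm (indicator {a<..<b} x *\<^sub>R s n x) \<le> indicator {a<..<b} x *\<^sub>R C" for n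
    using bound by (auto simp: indicator_def)
qed auto

text \<open>Tonelli's theorem for nonnegative functions is used, because no integrability of \<open>k\<close> is known
  in advance: at the kinks of the discrete states \<open>deriv\<close> has an unspecified value, and if \<open>k\<close> is not
  square-integrable, both sides are \<open>0\<close>.\<close>

lemma H_norm_fst:
  assumes y0: "y0 > 0" and [measurable]: "k \<in> borel_measurable borel"
    and f: "\<And>x y. (x, y) \<in> Omega x0 y0 \<Longrightarrow> f (x, y) = k x"
  shows "H_norm x0 y0 f = sqrt (y0 * (LINT x:{0<..<x0}|lborel. (k x)\<^sup>2))"
proof -
  let ?F = "\<lambda>p. indicator (Omega x0 y0) p *\<^sub>R (k (fst p))\<^sup>2"
  let ?f = "\<lambda>x. indicator {0<..<x0} x *\<^sub>R (k x)\<^sup>2"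
  have meas: "Omega x0 y0 \<in> sets borel"
    unfolding Omega_def by (intro borel_open open_Times) auto
  have "(fst :: real \<times> real \<Rightarrow> real) \<in> borel_measurable borel"
    by (intro borel_measurable_continuous_onI continuous_intros)
  then have "(\<lambda>p :: real \<times> real. k (fst p)) \<in> borel_measurable borel"
    by (rule measurable_compose) fact
  with meas have "?F \<in> borel_measurable borel"
    by (intro borel_measurable_scaleR borel_measurable_indicator borel_measurable_power)
  then have F: "?F \<in> borel_measurable (lborel \<Otimes>\<^sub>M lborel)"
    unfolding lborel_prod by simp
  have "(LINT p:Omega x0 y0|lborel. (f p)\<^sup>2) = (LINT p:Omega x0 y0|lborel. (k (fst p))\<^sup>2)"
    using meas f by (intro set_lebesgue_integral_cong) auto
  also have "\<dots> = integral\<^sup>L (lborel \<Otimes>\<^sub>M lborel) ?F"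
    by (simp add: set_lebesgue_integral_def lborel_prod)
  also have "\<dots> = enn2real (\<integral>\<^sup>+ p. ennreal (?F p) \<partial>(lborel \<Otimes>\<^sub>M lborel))"
    by (rule integral_eq_nn_integral[OF F]) auto
  also have "(\<integral>\<^sup>+ p. ennreal (?F p) \<partial>(lborel \<Otimes>\<^sub>M lborel)) =
      (\<integral>\<^sup>+ x. \<integral>\<^sup>+ y. ennreal (?F (x, y)) \<partial>lborel \<partial>lborel)"
    using F by (intro lborel.nn_integral_fst[symmetric]) simp
  also have "\<dots> = (\<integral>\<^sup>+ x. ennreal y0 * ennreal (?f x) \<partial>lborel)"
  proof (rule nn_integral_cong)
    fix x :: real
    have "(\<integral>\<^sup>+ y. ennreal (?F (x, y)) \<partial>lborel) =
        (\<integral>\<^sup>+ y. ennreal (?f x) * indicator {0<..<y0} y \<partial>lborel)"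
      by (rule nn_integral_cong) (auto simp: Omega_def indicator_def)
    also have "\<dots> = ennreal (?f x) * ennreal y0"
      using y0 by (simp add: nn_integral_cmult)
    finally show "(\<integral>\<^sup>+ y. ennreal (?F (x, y)) \<partial>lborel) = ennreal y0 * ennreal (?f x)"
      by (simp only: mult.commute)
  qed
  also have "enn2real \<dots> = y0 * enn2real (\<integral>\<^sup>+ x. ennreal (?f x) \<partial>lborel)"
    using y0 by (simp add: nn_integral_cmult enn2real_mult)
  also have "enn2real (\<integral>\<^sup>+ x. ennreal (?f x) \<partial>lborel) = (LINT x:{0<..<x0}|lborel. (k x)\<^sup>2)"
    unfolding set_lebesgue_integral_def by (rule integral_eq_nn_integral[symmetric]) auto
  finally show ?thesis by (simp add: H_norm_def)
qed

text \<open>Comparing the minimizer with the vertex \<open>\<beta> / a\<close> of the parabola, by completing the square.\<close>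

lemma quadratic_arg_min:
  fixes a :: real
  assumes "a > 0" "is_arg_min (\<lambda>q. c * (a * q\<^sup>2 - 2 * \<beta> * q + d)) (\<lambda>_. True) q" "c > 0"
  shows "a * q = \<beta>"
proof -
  let ?f = "\<lambda>q. a * q\<^sup>2 - 2 * \<beta> * q + d"
  have "c * ?f q \<le> c * ?f (\<beta> / a)"
    using assms(2) unfolding is_arg_min_def by (meson not_less)
  then have "?f q \<le> ?f (\<beta> / a)" using \<open>c > 0\<close> by simp
  then have "a * (?f q - ?f (\<beta> / a)) \<le> 0" using \<open>a > 0\<close> by (simp add: mult_le_0_iff)
  also have "a * (?f q - ?f (\<beta> / a)) = (a * q - \<beta>)\<^sup>2"
    using \<open>a > 0\<close> by (simp add: field_simps power2_eq_square)
  finally show ?thesis by simp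
qed

text \<open>Both the exact and the discrete state depend on the control only through the term \<open>- q * x\<close>.
  This makes the cost a quadratic polynomial in \<open>q\<close>, and the claim is its normal equation; the
  remaining part \<open>k\<close> of the state enters linearly, so errors in \<open>k\<close> transfer to the control.\<close>

lemma optimal_control_equation:
  assumes x0: "x0 > 0" and y0: "y0 > 0" and M: "M2 > 0"
    and [measurable]: "k \<in> borel_measurable borel"
    and bound: "\<And>x. x \<in> {0<..<x0} \<Longrightarrow> \<bar>k x\<bar> \<le> C"
    and v: "\<And>q x y. (x, y) \<in> Omega x0 y0 \<Longrightarrow> v q (x, y) = k x - q * x"
    and min: "is_arg_min (cost x0 y0 M2 zd v) (\<lambda>_. True) q"
  shows "(x0 ^ 3 / 3 + M2) * q = (LINT x:{0<..<x0}|lborel. (k x - zd) * x)"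
proof -
  let ?I = "\<lambda>f. LINT x:{0<..<x0}|lborel. (f x :: real)"
  define d where "d = ?I (\<lambda>x. (k x - zd)\<^sup>2)"
  define \<beta> where "\<beta> = ?I (\<lambda>x. (k x - zd) * x)"
  have kb: "\<bar>k x - zd\<bar> \<le> C + \<bar>zd\<bar>" "\<bar>x\<bar> \<le> x0" if "x \<in> {0<..<x0}" for x
    using bound[OF that] that by auto
  have C: "C + \<bar>zd\<bar> \<ge> 0" using kb(1)[of "x0 / 2"] x0 by auto
  have int: "set_integrable lborel {0<..<x0} (\<lambda>x. (k x - zd)\<^sup>2)"
       "set_integrable lborel {0<..<x0} (\<lambda>x. (k x - zd) * x)"
       "set_integrable lborel {0<..<x0} (\<lambda>x::real. x\<^sup>2)"
    by (rule set_integrable_Ioo_bounded[where C = "(C + \<bar>zd\<bar>)\<^sup>2"],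
        use kb C in \<open>auto simp: power2_le_iff_abs_le\<close>)
      (rule set_integrable_Ioo_bounded[where C = "(C + \<bar>zd\<bar>) * x0"],
        use kb C in \<open>auto simp: abs_mult intro!: mult_mono\<close>,
        rule set_integrable_Ioo_bounded[where C = "x0\<^sup>2"],
        use x0 in \<open>auto simp: power2_le_iff_abs_le\<close>)
  have sq: "?I (\<lambda>x. x\<^sup>2) = x0 ^ 3 / 3"
  proof (rule set_integral_Ioo_eq_has_integral[where C = "x0\<^sup>2"])
    have "((\<lambda>x. x\<^sup>2) has_integral (x0 ^ 3 / 3 - 0 ^ 3 / 3)) {0..x0}"
      using x0 by (intro fundamental_theorem_of_calculus)
        (auto intro!: derivative_eq_intros simp flip: has_real_derivative_iff_has_vector_derivative)
    then show "((\<lambda>x. x\<^sup>2) has_integral (x0 ^ 3 / 3)) {0..x0}" by simp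
  qed (use x0 in \<open>auto simp: power2_le_iff_abs_le\<close>)
  have "cost x0 y0 M2 zd v p = y0 / 2 * ((x0 ^ 3 / 3 + M2) * p\<^sup>2 - 2 * \<beta> * p + d)" for p
  proof -
    have "(H_norm x0 y0 (\<lambda>z. v p z - zd))\<^sup>2 = y0 * ?I (\<lambda>x. (k x - p * x - zd)\<^sup>2)"
    proof -
      have "H_norm x0 y0 (\<lambda>z. v p z - zd) = sqrt (y0 * ?I (\<lambda>x. (k x - p * x - zd)\<^sup>2))"
        by (rule H_norm_fst[OF y0]) (auto simp: v)
      moreover have "?I (\<lambda>x. (k x - p * x - zd)\<^sup>2) \<ge> 0"
        unfolding set_lebesgue_integral_def by (intro Bochner_Integration.integral_nonneg) auto
      ultimately show ?thesis using y0 by simp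
    qed
    also have "?I (\<lambda>x. (k x - p * x - zd)\<^sup>2) =
        ?I (\<lambda>x. ((k x - zd)\<^sup>2 - (2 * p) * ((k x - zd) * x)) + p\<^sup>2 * x\<^sup>2)"
      by (simp add: power2_eq_square algebra_simps)
    also have "\<dots> = d - (2 * p) * \<beta> + p\<^sup>2 * (x0 ^ 3 / 3)"
    proof -
      have i1: "set_integrable lborel {0<..<x0} (\<lambda>x. (k x - zd)\<^sup>2 - (2 * p) * ((k x - zd) * x))"
        using int by (intro set_integral_diff(1) set_integrable_mult_right)
      have i2: "set_integrable lborel {0<..<x0} (\<lambda>x. p\<^sup>2 * x\<^sup>2)"
        using int by (intro set_integrable_mult_right)
      have "?I (\<lambda>x. (k x - zd)\<^sup>2 - (2 * p) * ((k x - zd) * x)) = d - (2 * p) * \<beta>"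
        using int by (subst set_integral_diff(2)) (auto simp: d_def \<beta>_def)
      then show ?thesis using set_integral_add(2)[OF i1 i2] sq by simp
    qed
    finally have H: "(H_norm x0 y0 (\<lambda>z. v p z - zd))\<^sup>2 = y0 * (d - (2 * p) * \<beta> + p\<^sup>2 * (x0 ^ 3 / 3))" .
    have "(Q_norm x0 y0 (\<lambda>_. p))\<^sup>2 = y0 * p\<^sup>2"
      using y0 by (simp add: Q_norm_def set_lebesgue_integral_def)
    with H show ?thesis by (simp add: cost_def algebra_simps)
  qed
  then have "is_arg_min (\<lambda>p. y0 / 2 * ((x0 ^ 3 / 3 + M2) * p\<^sup>2 - 2 * \<beta> * p + d)) (\<lambda>_. True) q"
    using min by (metis (no_types, lifting) ext)
  from quadratic_arg_min[OF _ this] show ?thesis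
    using x0 y0 M by (simp add: \<beta>_def add_pos_pos)
qed

section \<open>Errors of the discrete states\<close>

text \<open>The distance from \<open>x\<close> to the right end of its cell. All errors of the discretization are
  polynomials in \<open>h\<close>, \<open>x\<close> and this number.\<close>

definition cell_gap :: "real \<Rightarrow> real \<Rightarrow> real" where
  "cell_gap h x = h * real_of_int \<lceil>x / h\<rceil> - x"

lemma cell_gap_bounds:
  assumes "h > 0"
  shows "0 \<le> cell_gap h x" "cell_gap h x < h"
proof -
  have "x / h \<le> real_of_int \<lceil>x / h\<rceil>" "real_of_int \<lceil>x / h\<rceil> < x / h + 1"
    by linarith+
  then have "x \<le> real_of_int \<lceil>x / h\<rceil> * h" "real_of_int \<lceil>x / h\<rceil> * h < (x / h + 1) * h"
    using assms by (simp_all only: pos_divide_le_eq mult_less_cancel_right_pos)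
  then show "0 \<le> cell_gap h x" "cell_gap h x < h"
    using assms by (simp_all add: cell_gap_def algebra_simps)
qed

lemma cell_gap_measurable [measurable]: "cell_gap h \<in> borel_measurable borel"
  unfolding cell_gap_def by measurable

text \<open>The difference of the exact and the discrete state for the same control, divided by \<open>g * h\<close>
  (see \<open>discrete_sol_defect\<close>). After this scaling it converges uniformly to \<open>x / 2\<close>.\<close>

definition scaled_defect :: "real \<Rightarrow> real \<Rightarrow> real" where
  "scaled_defect h x = (x + cell_gap h x * (h - cell_gap h x) / h) / 2"

lemma scaled_defect_measurable [measurable]: "scaled_defect h \<in> borel_measurable borel"
  unfolding scaled_defect_def by measurable

lemma scaled_defect_approx:
  assumes "h \<ge> 0"
  shows "\<bar>scaled_defect h x - x / 2\<bar> \<le> h / 2"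
proof (cases "h = 0")
  case False
  with assms have h: "h > 0" by simp
  define z where "z = cell_gap h x * (h - cell_gap h x) / h"
  have "cell_gap h x * (h - cell_gap h x) \<le> h * h" "0 \<le> cell_gap h x * (h - cell_gap h x)"
    using cell_gap_bounds[OF h, of x] h by (auto intro: mult_mono)
  then have "0 \<le> z" "z \<le> h"
    using h by (auto simp: z_def field_simps)
  moreover have "scaled_defect h x = (x + z) / 2" by (simp add: scaled_defect_def z_def)
  ultimately show ?thesis unfolding abs_le_iff by simp
qed (simp add: scaled_defect_def)

lemma discrete_sol_defect:
  assumes "x0 > 0" "n \<ge> 1"
  shows "discrete_sol x0 n g q b (x, y) =
    (- (1/2) * g * x\<^sup>2 + g * x0 * x + b) - g * (x0 / real n) * scaled_defect (x0 / real n) x - q * x"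
proof -
  define h where "h = x0 / real n"
  define i where "i = real_of_int \<lceil>x / h\<rceil>"
  have h: "h \<noteq> 0" using assms by (simp add: h_def)
  have "h * scaled_defect h x = (h * x + (h * i - x) * (h - (h * i - x))) / 2"
    using h by (simp add: scaled_defect_def cell_gap_def i_def field_simps)
  then have "g * (h * scaled_defect h x) = g * ((h * x + (h * i - x) * (h - (h * i - x))) / 2)"
    by simp
  moreover have "discrete_sol x0 n g q b (x, y) =
      (g * x0 - q - h * g * i) * x + h\<^sup>2 * g * (i * (i - 1) / 2) + b"
    by (simp add: discrete_sol_def Let_def h_def i_def)
  ultimately show ?thesis
    unfolding h_def[symmetric] mult.assoc
    by (simp add: algebra_simps add_divide_distrib diff_divide_distrib power2_eq_square)
qed

text \<open>The formula has to exclude the nodes, where the discrete state has kinks. The gap has size \<open>h\<close>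
  and oscillates in every cell, so that in general the derivative error does not converge pointwise after
  division by \<open>h\<close>. Its norm is therefore computed exactly.\<close>

lemma partial_x_discrete_sol:
  assumes "x0 > 0" "n \<ge> 1" "x / (x0 / real n) \<notin> \<int>"
  shows "partial_x (discrete_sol x0 n g q b) (x, y) =
    - g * x + (g * x0 - q) - g * cell_gap (x0 / real n) x"
proof -
  define h where "h = x0 / real n"
  define i where "i = real_of_int \<lceil>x / h\<rceil>"
  have h: "h > 0" using assms by (simp add: h_def)
  have x: "x \<in> {h * (i - 1)<..<h * i}"
  proof -
    have "x / h \<noteq> i" using assms(3) unfolding h_def i_def by (metis Ints_of_int)
    moreover have "x / h \<le> i" "i - 1 < x / h" unfolding i_def by linarith+
    ultimately have "i - 1 < x / h" "x / h < i" by auto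
    then show ?thesis using h by (auto simp: field_simps)
  qed
  have "((\<lambda>t. discrete_sol x0 n g q b (t, y)) has_real_derivative (g * x0 - q - h * g * i)) (at x)"
  proof (rule has_field_derivative_transform_within_open[OF _ _ x])
    show "((\<lambda>t. (g * x0 - q - h * g * i) * t + h\<^sup>2 * g * (i * (i - 1) / 2) + b)
        has_real_derivative (g * x0 - q - h * g * i)) (at x)"
      by (auto intro!: derivative_eq_intros)
    fix t assume t: "t \<in> {h * (i - 1)<..<h * i}"
    then have "i - 1 < t / h" "t / h \<le> i" using h by (auto simp: field_simps)
    then have "\<lceil>t / h\<rceil> = \<lceil>x / h\<rceil>" unfolding i_def by linarith
    then show "(g * x0 - q - h * g * i) * t + h\<^sup>2 * g * (i * (i - 1) / 2) + b =
        discrete_sol x0 n g q b (t, y)"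
      by (simp add: discrete_sol_def Let_def i_def flip: h_def)
  qed simp
  then have "partial_x (discrete_sol x0 n g q b) (x, y) = g * x0 - q - h * g * i"
    by (simp add: partial_x_def DERIV_imp_deriv)
  then show ?thesis
    by (simp add: cell_gap_def i_def algebra_simps flip: h_def)
qed

lemma has_integral_cell_gap_square:
  assumes h: "h > 0"
  shows "((\<lambda>x. (\<alpha> * cell_gap h x + \<beta>)\<^sup>2) has_integral
    real n * (\<alpha>\<^sup>2 * h ^ 3 / 3 + \<alpha> * \<beta> * h\<^sup>2 + \<beta>\<^sup>2 * h)) {0..real n * h}"
proof (induction n)
  case (Suc n)
  let ?J = "\<alpha>\<^sup>2 * h ^ 3 / 3 + \<alpha> * \<beta> * h\<^sup>2 + \<beta>\<^sup>2 * h"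
  let ?a = "real n * h" and ?b = "real (Suc n) * h"
  \<comment> \<open>a primitive on the last cell, where the gap is the distance to \<open>?b\<close>\<close>
  define G where "G x = - (\<alpha>\<^sup>2 * (?b - x) ^ 3 / 3 + \<alpha> * \<beta> * (?b - x)\<^sup>2 + \<beta>\<^sup>2 * (?b - x))" for x
  have ab: "?a \<le> ?b" using h by simp
  have "((\<lambda>x. (\<alpha> * (?b - x) + \<beta>)\<^sup>2) has_integral (G ?b - G ?a)) {?a..?b}"
  proof (rule fundamental_theorem_of_calculus[OF ab])
    fix x
    have "((\<lambda>x. - (\<alpha>\<^sup>2 * (c - x) ^ 3 / 3 + \<alpha> * \<beta> * (c - x)\<^sup>2 + \<beta>\<^sup>2 * (c - x)))
        has_real_derivative (\<alpha> * (c - x) + \<beta>)\<^sup>2) (at x within S)" for c S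
      by (auto intro!: derivative_eq_intros simp: power2_eq_square field_simps)
    then have "(G has_real_derivative (\<alpha> * (?b - x) + \<beta>)\<^sup>2) (at x within {?a..?b})"
      unfolding G_def .
    then show "(G has_vector_derivative (\<alpha> * (?b - x) + \<beta>)\<^sup>2) (at x within {?a..?b})"
      by (simp add: has_real_derivative_iff_has_vector_derivative)
  qed
  also have "G ?b - G ?a = ?J"
  proof -
    have "?b - ?a = h" by (simp add: algebra_simps)
    then show ?thesis by (simp add: G_def)
  qed
  finally have cell: "((\<lambda>x. (\<alpha> * cell_gap h x + \<beta>)\<^sup>2) has_integral ?J) {?a..?b}"
  proof (rule has_integral_spike_finite[of "{?a}", rotated 2])
    fix x assume "x \<in> {?a..?b} - {?a}"
    then have "real n < x / h" "x / h \<le> real (Suc n)" using h by (auto simp: field_simps)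
    then have "\<lceil>x / h\<rceil> = int (Suc n)" by (simp add: ceiling_eq_iff)
    then show "(\<alpha> * cell_gap h x + \<beta>)\<^sup>2 = (\<alpha> * (?b - x) + \<beta>)\<^sup>2"
      by (simp add: cell_gap_def mult.commute)
  qed simp
  have "((\<lambda>x. (\<alpha> * cell_gap h x + \<beta>)\<^sup>2) has_integral (real n * ?J + ?J)) {0..?b}"
    by (rule has_integral_combine[OF _ ab Suc.IH cell]) (use h in simp)
  also have "real n * ?J + ?J = real (Suc n) * ?J" by (simp only: of_nat_Suc distrib_right mult_1 add.commute)
  finally show ?case .
qed (auto intro: has_integral_refl)

section \<open>First-order convergence\<close>

lemma smallo_linear_if_quotient_tendsto:
  fixes f h :: "nat \<Rightarrow> real"
  assumes "\<forall>\<^sub>F n in sequentially. h n \<noteq> 0" "(\<lambda>n. f n / h n) \<longlonglongrightarrow> C"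
  shows "(\<lambda>n. f n - C * h n) \<in> o(h)"
proof (rule smalloI_tendsto)
  have "(\<lambda>n. f n / h n - C) \<longlonglongrightarrow> 0" using assms(2) by (simp add: LIM_zero)
  moreover have "\<forall>\<^sub>F n in sequentially. f n / h n - C = (f n - C * h n) / h n"
    using assms(1) by eventually_elim (simp add: field_simps)
  ultimately show "(\<lambda>n. (f n - C * h n) / h n) \<longlonglongrightarrow> 0" by (rule Lim_transform_eventually)
qed (fact assms(1))


theorem lemma11:
  fixes x0 y0 g b zd M2 q_op :: real
    and qh_op :: "nat \<Rightarrow> real"
    and u :: "real \<Rightarrow> real \<times> real \<Rightarrow> real"
  assumes "x0 > 0" and "y0 > 0" and "M2 > 0"
    and "\<And>q. solves_S x0 y0 g q b (u q)"
    and "is_arg_min (cost x0 y0 M2 zd u) (\<lambda>_. True) q_op"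
    and "\<And>n. n \<ge> 1 \<Longrightarrow>
           is_arg_min (cost x0 y0 M2 zd (\<lambda>q. discrete_sol x0 n g q b)) (\<lambda>_. True) (qh_op n)"
  shows "\<exists>C10 C11.
    (\<lambda>n. H_norm x0 y0 (\<lambda>p. discrete_sol x0 n g (qh_op n) b p - u q_op p)
           - C10 * (x0 / real n)) \<in> o(\<lambda>n. x0 / real n) \<and>
    (\<lambda>n. H_norm x0 y0 (\<lambda>p. partial_x (discrete_sol x0 n g (qh_op n) b) p
                               - partial_x (u q_op) p)
           - C11 * (x0 / real n)) \<in> o(\<lambda>n. x0 / real n)"
proof -
  note x0 = \<open>x0 > 0\<close> and y0 = \<open>y0 > 0\<close>
  let ?I = "\<lambda>f. LINT x:{0<..<x0}|lborel. (f x :: real)"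
  define h where "h n = x0 / real n" for n
  have h: "h n > 0" if "n \<ge> 1" for n using x0 that by (simp add: h_def)
  have h0: "h n \<ge> 0" "h n \<le> x0" for n using x0 by (cases n; simp add: h_def field_simps)+
  have h_ev: "\<forall>\<^sub>F n in sequentially. h n \<noteq> 0"
    using eventually_ge_at_top[of 1] by eventually_elim (use h in force)
  have h_lim: "h \<longlonglongrightarrow> 0" unfolding h_def by (rule lim_const_over_n)
  \<comment> \<open>\<open>U\<close> and \<open>U - h n * E n\<close> are the exact and the discrete state for the control \<open>0\<close>.\<close>
  define U where "U x = - (1/2) * g * x\<^sup>2 + g * x0 * x + b" for x
  define E where "E n x = g * scaled_defect (h n) x" for n x
  have [measurable]: "U \<in> borel_measurable borel" "E n \<in> borel_measurable borel" for n
    unfolding U_def E_def by measurable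
  obtain CU where CU: "\<bar>U x\<bar> \<le> CU" if "x \<in> {0<..<x0}" for x
  proof -
    have "bounded (U ` {0..x0})"
      unfolding U_def by (intro compact_imp_bounded compact_continuous_image continuous_intros) auto
    then obtain B where "\<forall>x\<in>{0..x0}. \<bar>U x\<bar> \<le> B" by (auto simp: bounded_iff)
    then show thesis by (intro that[of B]) auto
  qed
  have E_bound: "\<bar>E n x\<bar> \<le> \<bar>g\<bar> * x0" if "x \<in> {0<..<x0}" for n x
  proof -
    have "\<bar>scaled_defect (h n) x\<bar> \<le> x0" using scaled_defect_approx[OF h0(1)[of n], of x] h0(2)[of n] that
      unfolding abs_le_iff by auto
    then show ?thesis unfolding E_def by (simp add: abs_mult mult_left_mono)
  qed
  have E_lim: "(\<lambda>n. E n x) \<longlonglongrightarrow> g * (x / 2)" for x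
  proof -
    have "(\<lambda>n. scaled_defect (h n) x - x / 2) \<longlonglongrightarrow> 0"
    proof (rule Lim_null_comparison)
      show "\<forall>\<^sub>F n in sequentially. norm (scaled_defect (h n) x - x / 2) \<le> h n / 2"
        using scaled_defect_approx[OF h0(1)] by simp
      show "(\<lambda>n. h n / 2) \<longlonglongrightarrow> 0" using tendsto_divide[OF h_lim tendsto_const[of 2]] by simp
    qed
    then have "(\<lambda>n. scaled_defect (h n) x) \<longlonglongrightarrow> x / 2" by (simp add: LIM_zero_iff)
    then show ?thesis unfolding E_def by (intro tendsto_intros)
  qed

  have Ex_bound: "\<bar>E n x * x\<bar> \<le> \<bar>g\<bar> * x0 * x0" if x: "x \<in> {0<..<x0}" for n x
    using E_bound[OF x, of n] x unfolding abs_mult by (intro mult_mono) auto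

  define A where "A = x0 ^ 3 / 3 + M2"
  have A: "A > 0" using x0 \<open>M2 > 0\<close> by (simp add: A_def add_pos_pos)
  \<comment> \<open>the control error divided by \<open>h n\<close>; its limit comes from subtracting the two normal equations\<close>
  define \<rho> where "\<rho> n = (qh_op n - q_op) / h n" for n
  have \<rho>: "\<rho> n = - ?I (\<lambda>x. E n x * x) / A" if n: "n \<ge> 1" for n
  proof -
    have "A * q_op = ?I (\<lambda>x. (U x - zd) * x)" unfolding A_def
    proof (rule optimal_control_equation[OF x0 y0 \<open>M2 > 0\<close> _ CU _ assms(5)])
      show "u q (x, y) = U x - q * x" if "(x, y) \<in> Omega x0 y0" for q x y
        using solves_S_eq[OF x0 y0 assms(4) that] by (simp add: U_def)
    qed auto
    moreover have "A * qh_op n = ?I (\<lambda>x. ((U x - h n * E n x) - zd) * x)" unfolding A_def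
    proof (rule optimal_control_equation[OF x0 y0 \<open>M2 > 0\<close> _ _ _ assms(6)[OF n],
          where C = "CU + h n * (\<bar>g\<bar> * x0)"])
      fix x assume x: "x \<in> {0<..<x0}"
      have "\<bar>h n * E n x\<bar> \<le> h n * (\<bar>g\<bar> * x0)"
        using E_bound[OF x] h0 by (simp add: abs_mult mult_left_mono)
      then show "\<bar>U x - h n * E n x\<bar> \<le> CU + h n * (\<bar>g\<bar> * x0)" using CU[OF x] by linarith
    next
      show "discrete_sol x0 n g q b (x, y) = (U x - h n * E n x) - q * x" for q x y
        using discrete_sol_defect[OF x0 n] by (simp add: U_def E_def h_def)
    qed measurable
    moreover have "?I (\<lambda>x. (U x - zd) * x - h n * (E n x * x)) =
        ?I (\<lambda>x. (U x - zd) * x) - h n * ?I (\<lambda>x. E n x * x)"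
    proof (subst set_integral_diff)
      show "set_integrable lborel {0<..<x0} (\<lambda>x. (U x - zd) * x)"
      proof (rule set_integrable_Ioo_bounded[where C = "(CU + \<bar>zd\<bar>) * x0"])
        fix x assume x: "x \<in> {0<..<x0}"
        show "\<bar>(U x - zd) * x\<bar> \<le> (CU + \<bar>zd\<bar>) * x0"
          using CU[OF x] x unfolding abs_mult by (intro mult_mono) auto
      qed measurable
      show "set_integrable lborel {0<..<x0} (\<lambda>x. h n * (E n x * x))"
        by (intro set_integrable_mult_right set_integrable_Ioo_bounded[OF _ Ex_bound]) measurable
    qed simp
    ultimately have "A * (qh_op n - q_op) = - h n * ?I (\<lambda>x. E n x * x)"
      by (simp add: algebra_simps)
    then show ?thesis using h[OF n] A by (simp add: \<rho>_def field_simps)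
  qed
  define c where "c = - ?I (\<lambda>x. g * (x / 2) * x) / A"
  have \<rho>_lim: "\<rho> \<longlonglongrightarrow> c"
  proof (rule Lim_transform_eventually)
    show "(\<lambda>n. - ?I (\<lambda>x. E n x * x) / A) \<longlonglongrightarrow> c" unfolding c_def
    proof (intro tendsto_intros set_integral_Ioo_dominated_convergence E_lim)
      show "\<bar>E n x * x\<bar> \<le> \<bar>g\<bar> * x0 * x0" if "x \<in> {0<..<x0}" for n x
        using that by (rule Ex_bound)
    qed (use A in auto)
    show "\<forall>\<^sub>F n in sequentially. - ?I (\<lambda>x. E n x * x) / A = \<rho> n"
      using eventually_ge_at_top[of 1] by eventually_elim (simp add: \<rho>)
  qed
  obtain R where R: "\<And>n. \<bar>\<rho> n\<bar> \<le> R"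
    using convergent_imp_Bseq[OF convergentI[OF \<rho>_lim]] by (auto simp: Bseq_def)
  have \<rho>_eq: "qh_op n = q_op + h n * \<rho> n" if "n \<ge> 1" for n
    using h[OF that] by (simp add: \<rho>_def)

  let ?N = "\<lambda>n. H_norm x0 y0 (\<lambda>p. discrete_sol x0 n g (qh_op n) b p - u q_op p)"
  \<comment> \<open>the state error is \<open>- h n * ?K n\<close>, where \<open>?K n\<close> converges pointwise and boundedly\<close>
  let ?K = "\<lambda>n x. E n x + \<rho> n * x"
  have K_bound: "\<bar>?K n x\<bar> \<le> \<bar>g\<bar> * x0 + R * x0" if x: "x \<in> {0<..<x0}" for n x
  proof -
    have "\<bar>\<rho> n * x\<bar> \<le> R * x0"
      using R[of n] x unfolding abs_mult by (intro mult_mono) auto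
    then show ?thesis using E_bound[OF x, of n] by linarith
  qed
  have N: "?N n / h n = sqrt (y0 * ?I (\<lambda>x. (?K n x)\<^sup>2))" if n: "n \<ge> 1" for n
  proof -
    have "?N n = sqrt (y0 * ?I (\<lambda>x. (- h n * ?K n x)\<^sup>2))"
    proof (rule H_norm_fst[OF y0])
      fix x y assume xy: "(x, y) \<in> Omega x0 y0"
      show "discrete_sol x0 n g (qh_op n) b (x, y) - u q_op (x, y) = - h n * ?K n x"
        unfolding discrete_sol_defect[OF x0 n] solves_S_eq[OF x0 y0 assms(4) xy] \<rho>_eq[OF n]
        by (simp add: E_def algebra_simps flip: h_def)
    qed measurable
    also have "\<dots> = h n * sqrt (y0 * ?I (\<lambda>x. (?K n x)\<^sup>2))"
      using h0(1)[of n] by (simp add: power_mult_distrib real_sqrt_mult)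
    finally show ?thesis using h[OF n] by simp
  qed
  have "(\<lambda>n. ?N n / h n) \<longlonglongrightarrow> sqrt (y0 * ?I (\<lambda>x. (g * (x / 2) + c * x)\<^sup>2))"
  proof (rule Lim_transform_eventually)
    show "(\<lambda>n. sqrt (y0 * ?I (\<lambda>x. (?K n x)\<^sup>2))) \<longlonglongrightarrow> sqrt (y0 * ?I (\<lambda>x. (g * (x / 2) + c * x)\<^sup>2))"
    proof (intro tendsto_intros set_integral_Ioo_dominated_convergence E_lim \<rho>_lim)
      fix n x assume x: "x \<in> {0<..<x0}"
      have "\<bar>?K n x\<bar> \<le> \<bar>\<bar>g\<bar> * x0 + R * x0\<bar>" using K_bound[OF x, of n] by linarith
      then show "\<bar>(?K n x)\<^sup>2\<bar> \<le> (\<bar>g\<bar> * x0 + R * x0)\<^sup>2"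
        by (simp add: abs_le_square_iff)
    qed measurable
    show "\<forall>\<^sub>F n in sequentially. sqrt (y0 * ?I (\<lambda>x. (?K n x)\<^sup>2)) = ?N n / h n"
      using eventually_ge_at_top[of 1] by eventually_elim (simp add: N)
  qed
  note a = smallo_linear_if_quotient_tendsto[OF h_ev this]

  let ?P = "\<lambda>n. H_norm x0 y0 (\<lambda>p. partial_x (discrete_sol x0 n g (qh_op n) b) p - partial_x (u q_op) p)"
  \<comment> \<open>The derivative error is \<open>- (g * cell_gap (h n) x + h n * \<rho> n)\<close>. As \<open>cell_gap (h n) x / h n\<close>
    runs linearly through the unit interval in each cell, the normalized norm depends on \<open>n\<close>
    through \<open>\<rho> n\<close> only.\<close>
  let ?S = "\<lambda>\<sigma>. sqrt (y0 * x0 * (g\<^sup>2 / 3 + g * \<sigma> + \<sigma>\<^sup>2))"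
  have P: "?P n / h n = ?S (\<rho> n)" if n: "n \<ge> 1" for n
  proof -
    define \<delta> where "\<delta> = h n * \<rho> n"
    have q: "qh_op n = q_op + \<delta>" using \<rho>_eq[OF n] by (simp add: \<delta>_def)
    define \<kappa> where "\<kappa> x = partial_x (discrete_sol x0 n g (qh_op n) b) (x, 0)
      - (- g * x + (g * x0 - q_op))" for x
    \<comment> \<open>the nodes\<close>
    define X where "X = (\<lambda>i. h n * i) ` \<int>"
    have X: "countable X" by (simp add: X_def Ints_def)
    have \<kappa>: "\<kappa> x = - (g * cell_gap (h n) x + \<delta>)" if "x \<notin> X" for x
    proof -
      have "x / h n \<notin> \<int>"
      proof
        assume "x / h n \<in> \<int>"
        then have "h n * (x / h n) \<in> X" unfolding X_def by (rule imageI)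
        with that h[OF n] show False by simp
      qed
      then show ?thesis
        using partial_x_discrete_sol[OF x0 n, of x g "qh_op n" b 0]
        by (simp add: \<kappa>_def h_def q)
    qed
    have [measurable]: "\<kappa> \<in> borel_measurable borel"
    proof (rule measurable_discrete_difference[OF _ X])
      show "(\<lambda>x. - (g * cell_gap (h n) x + \<delta>)) \<in> borel_measurable borel" by measurable
    qed (auto simp: \<kappa>)
    have "?P n = sqrt (y0 * ?I (\<lambda>x. (\<kappa> x)\<^sup>2))"
    proof (rule H_norm_fst[OF y0])
      fix x y assume xy: "(x, y) \<in> Omega x0 y0"
      have "partial_x (discrete_sol x0 n g (qh_op n) b) (x, y) =
          partial_x (discrete_sol x0 n g (qh_op n) b) (x, 0)"
        by (simp add: partial_x_def discrete_sol_def)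
      then show "partial_x (discrete_sol x0 n g (qh_op n) b) (x, y) - partial_x (u q_op) (x, y) = \<kappa> x"
        unfolding partial_x_solves_S[OF x0 y0 assms(4) xy] by (simp add: \<kappa>_def)
    qed measurable
    also have "?I (\<lambda>x. (\<kappa> x)\<^sup>2) = ?I (\<lambda>x. (g * cell_gap (h n) x + \<delta>)\<^sup>2)"
    proof (rule set_lebesgue_integral_cong_AE)
      have "AE x in lborel. x \<notin> X" by (intro AE_not_in countable_imp_null_set_lborel X)
      then show "AE x\<in>{0<..<x0} in lborel. (\<kappa> x)\<^sup>2 = (g * cell_gap (h n) x + \<delta>)\<^sup>2"
        by eventually_elim (simp add: \<kappa> power2_eq_square algebra_simps)
    qed measurable
    also have "\<dots> = real n * (g\<^sup>2 * h n ^ 3 / 3 + g * \<delta> * (h n)\<^sup>2 + \<delta>\<^sup>2 * h n)"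
    proof (rule set_integral_Ioo_eq_has_integral[where C = "(\<bar>g\<bar> * h n + \<bar>\<delta>\<bar>)\<^sup>2"])
      have "real n * h n = x0" using n by (simp add: h_def)
      then show "((\<lambda>x. (g * cell_gap (h n) x + \<delta>)\<^sup>2) has_integral
          real n * (g\<^sup>2 * h n ^ 3 / 3 + g * \<delta> * (h n)\<^sup>2 + \<delta>\<^sup>2 * h n)) {0..x0}"
        using has_integral_cell_gap_square[OF h[OF n], of g \<delta> n] by simp
    next
      fix x
      have "\<bar>g * cell_gap (h n) x\<bar> \<le> \<bar>g\<bar> * h n"
        using cell_gap_bounds[OF h[OF n], of x] unfolding abs_mult by (intro mult_left_mono) auto
      then have "\<bar>g * cell_gap (h n) x + \<delta>\<bar> \<le> \<bar>\<bar>g\<bar> * h n + \<bar>\<delta>\<bar>\<bar>" by linarith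
      then show "\<bar>(g * cell_gap (h n) x + \<delta>)\<^sup>2\<bar> \<le> (\<bar>g\<bar> * h n + \<bar>\<delta>\<bar>)\<^sup>2"
        by (simp add: abs_le_square_iff)
    qed measurable
    also have "y0 * \<dots> = (h n)\<^sup>2 * (y0 * (real n * h n) * (g\<^sup>2 / 3 + g * \<rho> n + (\<rho> n)\<^sup>2))"
      by (simp add: \<delta>_def power2_eq_square power3_eq_cube algebra_simps)
    also have "real n * h n = x0" using n by (simp add: h_def)
    finally show ?thesis using h[OF n] by (simp add: real_sqrt_mult)
  qed
  have "(\<lambda>n. ?P n / h n) \<longlonglongrightarrow> ?S c"
  proof (rule Lim_transform_eventually)
    show "(\<lambda>n. ?S (\<rho> n)) \<longlonglongrightarrow> ?S c" by (intro tendsto_intros \<rho>_lim)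
    show "\<forall>\<^sub>F n in sequentially. ?S (\<rho> n) = ?P n / h n"
      using eventually_ge_at_top[of 1] by eventually_elim (simp add: P)
  qed
  note b = smallo_linear_if_quotient_tendsto[OF h_ev this]
  show ?thesis using a b unfolding h_def by blast
qed

end
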